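(* Let $\Omega\subset\mathbb{R}^d$ be open and bounded and $\Gamma\subset\mathbb{R}^s$ compact. Let $(E,\mu)\in\mathcal{M}(\Omega\times\Gamma,\mathbb{R}^{d,s}\times\mathbb{R})$ be a solution of the first-order continuity equation $\nabla_x\mu+\operatorname{div}_zE=0$, with a Radon-Nikodym density $\mathrm{d}E/\mathrm{d}\mu=:e=(e_1,\dots,e_d)\in L^1_\mu(\Omega\times\Gamma,\mathbb{R}^{d,s})$, where $e_1,\dots,e_d$ are the $\mathbb{R}^s$-valued rows of $e$, that additionally satisfies $$\int_{\Omega\times\Gamma}\langle\nabla_x\phi,\mathrm{d}E\rangle+\int_{\Omega\times\Gamma}\sum_{i=1}^d\langle\nabla_z\phi,e_i\otimes e_i\rangle\,\mathrm{d}\mu=0\qquad\forall\phi\in C_c^1(\Omega\times\Gamma,\mathbb{R}^s).$$ Then the triple $\big((\sum_{i=1}^de_i\otimes e_i)\mu,\,0,\,\mu\big)\in\mathcal{M}(\Omega\times\Gamma,\mathbb{R}^{s,s}\times\mathbb{R}^s\times\mathbb{R})$ is a solution of the Laplacian continuity equation $-\Delta_x\mu-\operatorname{div}_zE'+\operatorname{div}_z^2H'=0$ (with $H'=(\sum_{i=1}^de_i\otimes e_i)\mu$ and $E'=0$).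
   Context: Points of $\Omega\times\Gamma$ are written $(x,z)$; derivatives with index $x$ (resp. $z$) are with respect to the $\Omega$- (resp. $\Gamma$-) variable. $\mathcal{M}(\Omega\times\Gamma,\mathbb{R}^k)$ is the space of (finite) $\mathbb{R}^k$-valued Radon measures on $\Omega\times\Gamma$. $\langle\cdot,\cdot\rangle$ is the Euclidean entrywise inner product, $\mathbb{R}^{d,s}$ denotes real $d\times s$ matrices. $C_c^r(\Omega\times\Gamma,\mathbb{R}^k)$ denotes $r$ times continuously differentiable functions with compact support in the first variable; concretely, functions $\phi$ of class $C^r$ on $\Omega\times\mathbb{R}^s$ for which there is a compact $K\subset\Omega$ with $\phi(x,z)=0$ for $x\notin K$, used on $\Omega\times\Gamma$. A pair $(E,\mu)\in\mathcal{M}(\Omega\times\Gamma,\mathbb{R}^{d,s}\times\mathbb{R})$ solves the first-order continuity equation if $$\int\operatorname{div}_x\phi\,\mathrm{d}\mu+\int\langle\nabla_z\phi^{\top},\mathrm{d}E\rangle=0\qquad\forall\phi\in C_c^1(\Omega\times\Gamma,\mathbb{R}^d),$$ where $(\nabla_z\phi^{\top})_{i,k}=\partial_{z_k}\phi_i$. For $\phi\in C_c^1(\Omega\times\Gamma,\mathbb{R}^s)$, $(\nabla_x\phi)_{i,k}=\partial_{x_i}\phi_k$ (a $d\times s$ matrix) and $\nabla_z\phi$ is the $s\times s$ matrix of derivatives $\partial_{z_l}\phi_k$. A triple $(H',E',\mu)\in\mathcal{M}(\Omega\times\Gamma,\mathbb{R}^{s,s}\times\mathbb{R}^s\times\mathbb{R})$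 solves the Laplacian continuity equation if $$-\int\Delta_x\phi\,\mathrm{d}\mu+\int\langle\nabla_z\phi,\mathrm{d}E'\rangle+\int\langle\nabla_z^2\phi,\mathrm{d}H'\rangle=0\qquad\forall\phi\in C_c^2(\Omega\times\Gamma,\mathbb{R}).$$
   Formalization: It is additionally assumed that the density sum of e_i ⊗ e_i is μ-integrable, i.e. that (sum e_i ⊗ e_i)μ is a finite measure; this does not follow from e in L^1_μ and the two equations, so the claimed membership of the triple in M can fail without it. *)

theory Defs
  imports "HOL-Analysis.Analysis"
begin

text \<open>
  A finite vector-valued measure on the measurable space underlying \<open>M\<close> is a countably additive
  set function with values in a normed space (the choice \<open>A n = {}\<close> forces \<open>\<nu> {} = 0\<close>); the
  measure stored in \<open>M\<close> plays no role, and neither do the values of \<open>\<nu>\<close> outside \<open>sets M\<close>.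
  Scalar signed measures are the case of real values.
\<close>

definition vector_measure :: "'a measure \<Rightarrow> ('a set \<Rightarrow> 'b::real_normed_vector) \<Rightarrow> bool" where
  "vector_measure M \<nu> \<longleftrightarrow>
    (\<forall>A :: nat \<Rightarrow> 'a set. range A \<subseteq> sets M \<longrightarrow> disjoint_family A \<longrightarrow>
      (\<lambda>n. \<nu> (A n)) sums \<nu> (\<Union>n. A n))"

text \<open>
  The positive and negative parts of the Jordan decomposition. The truncation of negative values
  by \<^const>\<open>ennreal\<close> is harmless because \<open>B = {}\<close> contributes 0 to the supremum.
\<close>

definition pos_variation :: "'a measure \<Rightarrow> ('a set \<Rightarrow> real) \<Rightarrow> 'a measure" where
  "pos_variation M \<nu> =
    measure_of (space M) (sets M) (\<lambda>A. SUP B\<in>{B \<in> sets M. B \<subseteq> A}. ennreal (\<nu> B))"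

definition neg_variation :: "'a measure \<Rightarrow> ('a set \<Rightarrow> real) \<Rightarrow> 'a measure" where
  "neg_variation M \<nu> = pos_variation M (\<lambda>A. - \<nu> A)"

text \<open>Membership in \<open>L\<^sup>1\<close> of the total variation, which is the sum of the two parts.\<close>

definition signed_integrable ::
    "'a measure \<Rightarrow> ('a set \<Rightarrow> real) \<Rightarrow> ('a \<Rightarrow> 'b::{banach, second_countable_topology}) \<Rightarrow> bool" where
  "signed_integrable M \<nu> f \<longleftrightarrow>
    integrable (pos_variation M \<nu>) f \<and> integrable (neg_variation M \<nu>) f"

definition signed_integral ::
    "'a measure \<Rightarrow> ('a set \<Rightarrow> real) \<Rightarrow> ('a \<Rightarrow> 'b::{banach, second_countable_topology}) \<Rightarrow> 'b" where
  "signed_integral M \<nu> f =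
    integral\<^sup>L (pos_variation M \<nu>) f - integral\<^sup>L (neg_variation M \<nu>) f"

text \<open>
  The pairing \<open>\<integral>\<langle>F, dE\<rangle>\<close>, summed over the components of \<open>E\<close>. On matrices the inner product of the
  type \<open>real^'n^'m\<close> is the entrywise one.
\<close>

definition vector_pairing ::
    "'a measure \<Rightarrow> ('a \<Rightarrow> 'b::euclidean_space) \<Rightarrow> ('a set \<Rightarrow> 'b) \<Rightarrow> real" where
  "vector_pairing M F E =
    (\<Sum>b\<in>Basis. signed_integral M (\<lambda>A. E A \<bullet> b) (\<lambda>p. F p \<bullet> b))"

definition signed_density ::
    "'a measure \<Rightarrow> ('a set \<Rightarrow> real) \<Rightarrow> ('a \<Rightarrow> 'b::{banach, second_countable_topology})
      \<Rightarrow> 'a set \<Rightarrow> 'b" where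
  "signed_density M \<nu> f = (\<lambda>A. signed_integral M \<nu> (\<lambda>p. indicat_real A p *\<^sub>R f p))"

definition has_RN_density ::
    "'a measure \<Rightarrow> ('a set \<Rightarrow> 'b::{banach, second_countable_topology}) \<Rightarrow> ('a set \<Rightarrow> real)
      \<Rightarrow> ('a \<Rightarrow> 'b) \<Rightarrow> bool" where
  "has_RN_density M E \<nu> f \<longleftrightarrow>
    signed_integrable M \<nu> f \<and> (\<forall>A\<in>sets M. E A = signed_density M \<nu> f A)"

text \<open>
  Class \<open>C\<^sup>r\<close> for open \<open>S\<close>. In finite dimension, continuity of the derivative as a linear map amounts
  to continuity of all directional derivatives.
\<close>

primrec class_C_on ::
    "nat \<Rightarrow> 'a::euclidean_space set \<Rightarrow> ('a \<Rightarrow> 'b::real_normed_vector) \<Rightarrow> bool" where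
  "class_C_on 0 S f \<longleftrightarrow> continuous_on S f"
| "class_C_on (Suc r) S f \<longleftrightarrow>
    (\<forall>p\<in>S. f differentiable (at p)) \<and>
    (\<forall>v. class_C_on r S (\<lambda>p. frechet_derivative f (at p) v))"

text \<open>
  Test functions are of class \<open>C\<^sup>r\<close> on \<open>\<Omega> \<times> \<real>\<^sup>s\<close> and compactly supported in the first variable only;
  their values at points with first component outside \<open>\<Omega>\<close> are irrelevant.
\<close>

definition test_functions ::
    "nat \<Rightarrow> (real^'d) set \<Rightarrow> ((real^'d) \<times> (real^'s) \<Rightarrow> 'b::real_normed_vector) set" where
  "test_functions r \<Omega> = {\<phi>. class_C_on r (\<Omega> \<times> UNIV) \<phi> \<and>
    (\<exists>K. compact K \<and> K \<subseteq> \<Omega> \<and> (\<forall>x\<in>\<Omega> - K. \<forall>z. \<phi> (x, z) = 0))}"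

definition partial_x ::
    "'d \<Rightarrow> ((real^'d) \<times> (real^'s) \<Rightarrow> 'b::real_normed_vector) \<Rightarrow> (real^'d) \<times> (real^'s) \<Rightarrow> 'b" where
  "partial_x i \<phi> p = frechet_derivative \<phi> (at p) (axis i 1, 0)"

definition partial_z ::
    "'s \<Rightarrow> ((real^'d) \<times> (real^'s) \<Rightarrow> 'b::real_normed_vector) \<Rightarrow> (real^'d) \<times> (real^'s) \<Rightarrow> 'b" where
  "partial_z k \<phi> p = frechet_derivative \<phi> (at p) (0, axis k 1)"

definition div_x ::
    "((real^'d) \<times> (real^'s) \<Rightarrow> real^'d) \<Rightarrow> (real^'d) \<times> (real^'s) \<Rightarrow> real" where
  "div_x \<phi> p = (\<Sum>i\<in>UNIV. partial_x i \<phi> p $ i)"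

text \<open>
  The matrix type \<open>real^'n^'m\<close> has rows indexed by \<open>'m\<close> and columns by \<open>'n\<close>. The Jacobian with respect
  to \<open>z\<close> has the entry \<open>\<partial>\<phi>\<^sub>i/\<partial>z\<^sub>k\<close> in row \<open>i\<close> and column \<open>k\<close>, whereas the gradient with respect to \<open>x\<close>
  has \<open>\<partial>\<phi>\<^sub>k/\<partial>x\<^sub>i\<close> there.
\<close>

definition jacobian_z ::
    "((real^'d) \<times> (real^'s) \<Rightarrow> real^'m) \<Rightarrow> (real^'d) \<times> (real^'s) \<Rightarrow> real^'s^'m" where
  "jacobian_z \<phi> p = (\<chi> i k. partial_z k \<phi> p $ i)"

definition grad_x ::
    "((real^'d) \<times> (real^'s) \<Rightarrow> real^'m) \<Rightarrow> (real^'d) \<times> (real^'s) \<Rightarrow> real^'m^'d" where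
  "grad_x \<phi> p = (\<chi> i k. partial_x i \<phi> p $ k)"

definition grad_z ::
    "((real^'d) \<times> (real^'s) \<Rightarrow> real) \<Rightarrow> (real^'d) \<times> (real^'s) \<Rightarrow> real^'s" where
  "grad_z \<phi> p = (\<chi> k. partial_z k \<phi> p)"

definition hessian_z ::
    "((real^'d) \<times> (real^'s) \<Rightarrow> real) \<Rightarrow> (real^'d) \<times> (real^'s) \<Rightarrow> real^'s^'s" where
  "hessian_z \<phi> p = (\<chi> k l. partial_z k (partial_z l \<phi>) p)"

definition laplacian_x ::
    "((real^'d) \<times> (real^'s) \<Rightarrow> real) \<Rightarrow> (real^'d) \<times> (real^'s) \<Rightarrow> real" where
  "laplacian_x \<phi> p = (\<Sum>i\<in>UNIV. partial_x i (partial_x i \<phi>) p)"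

definition outer :: "real^'m \<Rightarrow> real^'n \<Rightarrow> real^'n^'m" where
  "outer u v = (\<chi> k l. u $ k * v $ l)"

text \<open>
  The Borel \<open>\<sigma>\<close>-algebra of \<open>\<Omega> \<times> \<Gamma>\<close>. For open \<open>\<Omega>\<close> and compact \<open>\<Gamma>\<close> this space is locally compact and
  \<open>\<sigma>\<close>-compact metrizable, so every finite Borel measure on it, also signed or vector-valued, is Radon.
\<close>

abbreviation borel_prod ::
    "(real^'d) set \<Rightarrow> (real^'s) set \<Rightarrow> ((real^'d) \<times> (real^'s)) measure" where
  "borel_prod \<Omega> \<Gamma> \<equiv> restrict_space borel (\<Omega> \<times> \<Gamma>)"

definition first_order_solution ::
    "(real^'d) set \<Rightarrow> (real^'s) set \<Rightarrow> (((real^'d) \<times> (real^'s)) set \<Rightarrow> real^'s^'d)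
      \<Rightarrow> (((real^'d) \<times> (real^'s)) set \<Rightarrow> real) \<Rightarrow> bool" where
  "first_order_solution \<Omega> \<Gamma> E \<mu> \<longleftrightarrow>
    vector_measure (borel_prod \<Omega> \<Gamma>) E \<and>
    vector_measure (borel_prod \<Omega> \<Gamma>) \<mu> \<and>
    (\<forall>\<phi> \<in> test_functions 1 \<Omega>.
      signed_integral (borel_prod \<Omega> \<Gamma>) \<mu> (div_x \<phi>)
      + vector_pairing (borel_prod \<Omega> \<Gamma>) (jacobian_z \<phi>) E = 0)"

definition laplacian_solution ::
    "(real^'d) set \<Rightarrow> (real^'s) set \<Rightarrow> (((real^'d) \<times> (real^'s)) set \<Rightarrow> real^'s^'s)
      \<Rightarrow> (((real^'d) \<times> (real^'s)) set \<Rightarrow> real^'s) \<Rightarrow> (((real^'d) \<times> (real^'s)) set \<Rightarrow> real) \<Rightarrow> bool" where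
  "laplacian_solution \<Omega> \<Gamma> H E \<mu> \<longleftrightarrow>
    vector_measure (borel_prod \<Omega> \<Gamma>) H \<and>
    vector_measure (borel_prod \<Omega> \<Gamma>) E \<and>
    vector_measure (borel_prod \<Omega> \<Gamma>) \<mu> \<and>
    (\<forall>\<phi> \<in> test_functions 2 \<Omega>.
      - signed_integral (borel_prod \<Omega> \<Gamma>) \<mu> (laplacian_x \<phi>)
      + vector_pairing (borel_prod \<Omega> \<Gamma>) (grad_z \<phi>) E
      + vector_pairing (borel_prod \<Omega> \<Gamma>) (hessian_z \<phi>) H = 0)"

end

theory Submission
  imports Defs
begin

text \<open>
  For a scalar test function \<open>\<phi>\<close> of class \<open>C\<^sup>2\<close>, both \<open>\<nabla>\<^sub>x\<phi>\<close> and \<open>\<nabla>\<^sub>z\<phi>\<close> are test functions of class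
  \<open>C\<^sup>1\<close>. Testing the first-order continuity equation with \<open>\<nabla>\<^sub>x\<phi>\<close> gives
  \<open>\<integral>\<Delta>\<^sub>x\<phi> d\<mu> = - \<integral>\<langle>\<nabla>\<^sub>z\<nabla>\<^sub>x\<phi>, dE\<rangle>\<close>, testing the additional identity with \<open>\<nabla>\<^sub>z\<phi>\<close> gives
  \<open>\<integral>\<langle>\<nabla>\<^sub>z\<^sup>2\<phi>, \<Sum>\<^sub>i e\<^sub>i \<otimes> e\<^sub>i\<rangle> d\<mu> = - \<integral>\<langle>\<nabla>\<^sub>x\<nabla>\<^sub>z\<phi>, dE\<rangle>\<close>, and the right-hand sides agree by the symmetry of
  second derivatives. The measure-theoretic point is that integrating a bounded function \<open>F\<close> against
  the Jordan parts of the components of \<open>H' = f\<mu>\<close> is the same as integrating \<open>\<langle>F, f\<rangle>\<close> against \<open>\<mu>\<close>.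
\<close>

subsection \<open>Integration against densities of signed measures\<close>

text \<open>Addition lets identities between differences of measures be stated as equalities of
  nonnegative measures, with no subtraction of possibly infinite values.\<close>

definition plus_measure :: "'a measure \<Rightarrow> 'a measure \<Rightarrow> 'a measure" where
  "plus_measure M N = measure_of (space M) (sets M) (\<lambda>A. emeasure M A + emeasure N A)"

lemma space_plus_measure [simp]: "space (plus_measure M N) = space M"
  by (simp add: plus_measure_def)

lemma sets_plus_measure [simp, measurable_cong]: "sets (plus_measure M N) = sets M"
  by (simp add: plus_measure_def)

lemma emeasure_plus_measure:
  assumes [simp]: "sets N = sets M" and "A \<in> sets M"
  shows "emeasure (plus_measure M N) A = emeasure M A + emeasure N A"
  unfolding plus_measure_def
proof (rule emeasure_measure_of_sigma)
  show "sigma_algebra (space M) (sets M)" ..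
  show "positive (sets M) (\<lambda>A. emeasure M A + emeasure N A)"
    by (simp add: positive_def)
  show "countably_additive (sets M) (\<lambda>A. emeasure M A + emeasure N A)"
    by (auto simp: countably_additive_def suminf_add[symmetric] suminf_emeasure)
qed fact

lemma finite_measure_plus_measure:
  assumes "finite_measure M" "finite_measure N" and [simp]: "sets N = sets M"
  shows "finite_measure (plus_measure M N)"
proof (rule finite_measureI)
  have "space N = space M"
    by (rule sets_eq_imp_space_eq) simp
  then show "emeasure (plus_measure M N) (space (plus_measure M N)) \<noteq> \<infinity>"
    using finite_measure.emeasure_finite[OF assms(1)] finite_measure.emeasure_finite[OF assms(2)]
    by (simp add: emeasure_plus_measure)
qed

text \<open>Induction over nonnegative measurable functions: indicators give the definition of the
  sum, and both sides respect scaling, addition and increasing limits.\<close>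

lemma nn_integral_plus_measure:
  assumes [simp]: "sets N = sets M" and "f \<in> borel_measurable M"
  shows "(\<integral>\<^sup>+x. f x \<partial>plus_measure M N) = (\<integral>\<^sup>+x. f x \<partial>M) + (\<integral>\<^sup>+x. f x \<partial>N)"
proof -
  have sp [simp]: "space N = space M"
    by (rule sets_eq_imp_space_eq) simp
  have m: "g \<in> borel_measurable (plus_measure M N) \<longleftrightarrow> g \<in> borel_measurable M"
    "g \<in> borel_measurable N \<longleftrightarrow> g \<in> borel_measurable M" for g :: "'a \<Rightarrow> ennreal"
    by (simp_all cong: measurable_cong_sets)
  show ?thesis
    using assms(2)
  proof (induction rule: borel_measurable_induct)
    case (cong f g)
    then have "integral\<^sup>N K f = integral\<^sup>N K g" if "space K = space M" for K
      using that by (intro nn_integral_cong) simp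
    with cong show ?case by simp
  next
    case (set A)
    then show ?case by (simp add: emeasure_plus_measure)
  next
    case (mult u c)
    then show ?case by (simp add: m nn_integral_cmult distrib_left)
  next
    case (add u v)
    then show ?case by (simp add: m nn_integral_add ac_simps)
  next
    case (seq U)
    have eq: "integral\<^sup>N K (Sup (range U)) = (SUP i. integral\<^sup>N K (U i))" if "sets K = sets M" for K
    proof -
      have "integral\<^sup>N K (Sup (range U)) = (\<integral>\<^sup>+x. (SUP i. U i x) \<partial>K)"
        by (intro nn_integral_cong) (simp add: image_comp)
      also have "\<dots> = (SUP i. integral\<^sup>N K (U i))"
        using seq that
        by (intro nn_integral_monotone_convergence_SUP) (auto cong: measurable_cong_sets)
      finally show ?thesis .
    qed
    \<comment> \<open>Monotonicity is what allows the sum of the two suprema to be taken as one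
      supremum.\<close>
    have inc: "incseq (\<lambda>i. integral\<^sup>N K (U i))" for K
      using seq(3) by (auto simp: incseq_def le_fun_def intro!: nn_integral_mono)
    show ?case
      unfolding eq[OF sets_plus_measure] eq[OF refl] eq[OF assms(1)] seq(5)
      by (rule ennreal_SUP_add[OF inc inc])
  qed
qed

lemma integral_plus_measure:
  fixes f :: "'a \<Rightarrow> real"
  assumes [simp]: "sets N = sets M" and f: "integrable M f" "integrable N f"
  shows "(\<integral>x. f x \<partial>plus_measure M N) = (\<integral>x. f x \<partial>M) + (\<integral>x. f x \<partial>N)"
proof -
  have [measurable]: "f \<in> borel_measurable M" using f by simp
  have m: "f \<in> borel_measurable (plus_measure M N)"
    by simp
  have i: "integrable (plus_measure M N) f"
    using f by (simp add: integrable_iff_bounded nn_integral_plus_measure)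
  \<comment> \<open>Applied to \<open>f\<close> and \<open>- f\<close>, this makes all four
    integrals in the split into positive and negative parts finite, so that \<open>enn2real\<close>
    is additive on them.\<close>
  have "(\<integral>\<^sup>+x. ennreal (g x) \<partial>K) < \<infinity>"
    if "integrable K f" "\<And>x. \<bar>g x\<bar> \<le> \<bar>f x\<bar>" for g K
  proof -
    have "(\<integral>\<^sup>+x. ennreal (g x) \<partial>K) \<le> (\<integral>\<^sup>+x. ennreal (norm (f x)) \<partial>K)"
      using that(2) by (intro nn_integral_mono ennreal_leI) (metis abs_ge_self order_trans real_norm_def)
    then show ?thesis
      using that(1) by (auto simp: integrable_iff_bounded intro: le_less_trans)
  qed
  from this[OF f(1), of f] this[OF f(1), of "\<lambda>x. - f x"]
    this[OF f(2), of f] this[OF f(2), of "\<lambda>x. - f x"]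
  show ?thesis
    using f i
    by (simp add: real_lebesgue_integral_def nn_integral_plus_measure enn2real_plus less_top)
qed

section \<open>Jordan parts and the signed integral\<close>

lemma sets_pos_variation [simp, measurable_cong]: "sets (pos_variation M \<nu>) = sets M"
  by (simp add: pos_variation_def)

lemma sets_neg_variation [simp, measurable_cong]: "sets (neg_variation M \<nu>) = sets M"
  by (simp add: neg_variation_def)

text \<open>The supremum runs over measurable sets only. This permits replacing a set function by
  one that is known to agree with it just there.\<close>

lemma pos_variation_cong:
  assumes "\<And>A. A \<in> sets M \<Longrightarrow> \<nu> A = \<nu>' A"
  shows "pos_variation M \<nu> = pos_variation M \<nu>'"
  unfolding pos_variation_def
  by (intro measure_of_eq sets.space_closed SUP_cong) (use assms in auto)

lemma (in finite_measure) measure_Int_Diff: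
  assumes "A \<in> sets M" "B \<in> sets M"
  shows "measure M A = measure M (A \<inter> B) + measure M (A - B)"
  using assms finite_measure_Union[of "A \<inter> B" "A - B"] by (auto simp: Int_Diff_Un)

text \<open>\<open>Y\<close> is a positive Hahn set of \<alpha> - \<beta>, and the supremum over the
  measurable subsets of \<open>A\<close> is attained at \<open>A \<inter> Y\<close>.\<close>

lemma emeasure_pos_variation:
  assumes \<alpha>: "finite_measure \<alpha>" and \<beta>: "finite_measure \<beta>"
    and [simp]: "sets \<alpha> = sets M" "sets \<beta> = sets M"
    and \<nu>: "\<And>A. A \<in> sets M \<Longrightarrow> \<nu> A = measure \<alpha> A - measure \<beta> A"
    and Y [measurable]: "Y \<in> sets M"
    and pos: "\<And>X. X \<in> sets M \<Longrightarrow> X \<subseteq> Y \<Longrightarrow> measure \<beta> X \<le> measure \<alpha> X"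
    and neg: "\<And>X. X \<in> sets M \<Longrightarrow> X \<inter> Y = {} \<Longrightarrow> measure \<alpha> X \<le> measure \<beta> X"
    and A [measurable]: "A \<in> sets M"
  shows "emeasure (pos_variation M \<nu>) A = ennreal (measure \<alpha> (A \<inter> Y) - measure \<beta> (A \<inter> Y))"
proof -
  interpret \<alpha>: finite_measure \<alpha> by fact
  interpret \<beta>: finite_measure \<beta> by fact
  have [simp]: "space \<alpha> = space M" "space \<beta> = space M"
    by (rule sets_eq_imp_space_eq, simp)+
  \<comment> \<open>The restrictions of \<alpha> and \<beta> to \<open>Y\<close>; on them \<beta>
    lies below \<alpha>, so their difference is a measure.\<close>
  define \<alpha>Y where "\<alpha>Y = density \<alpha> (indicator Y)"
  define \<beta>Y where "\<beta>Y = density \<beta> (indicator Y)"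
  have [simp]: "sets \<alpha>Y = sets M" "sets \<beta>Y = sets M" "space \<alpha>Y = space M" "space \<beta>Y = space M"
    by (simp_all add: \<alpha>Y_def \<beta>Y_def)
  have em: "emeasure \<alpha>Y B = ennreal (measure \<alpha> (B \<inter> Y))"
    "emeasure \<beta>Y B = ennreal (measure \<beta> (B \<inter> Y))" if "B \<in> sets M" for B
    using that emeasure_restricted[of Y \<alpha> B] emeasure_restricted[of Y \<beta> B]
    by (simp_all only: \<alpha>Y_def \<beta>Y_def Int_commute assms(3,4) Y
        \<alpha>.emeasure_eq_measure \<beta>.emeasure_eq_measure)
  have sup: "(SUP C\<in>{C \<in> sets M. C \<subseteq> B}. ennreal (\<nu> C)) = emeasure \<alpha>Y B - emeasure \<beta>Y B"
    if B [measurable]: "B \<in> sets M" for B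
  proof -
    have "(SUP C\<in>{C \<in> sets M. C \<subseteq> B}. ennreal (\<nu> C)) = ennreal (\<nu> (B \<inter> Y))"
    proof (rule antisym)
      show "(SUP C\<in>{C \<in> sets M. C \<subseteq> B}. ennreal (\<nu> C)) \<le> ennreal (\<nu> (B \<inter> Y))"
      proof (rule SUP_least)
        fix C assume "C \<in> {C \<in> sets M. C \<subseteq> B}"
        then have C [measurable]: "C \<in> sets M" and CB: "C \<subseteq> B" by auto
        \<comment> \<open>Passing from \<open>C\<close> to \<open>B \<inter> Y\<close> discards
          \<open>C - Y\<close>, where \<nu> is at most 0, and adds
          \<open>(B - C) \<inter> Y\<close>, where \<nu> is at least 0.\<close>
        have "measure \<alpha> C = measure \<alpha> (C \<inter> Y) + measure \<alpha> (C - Y)"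
          "measure \<beta> C = measure \<beta> (C \<inter> Y) + measure \<beta> (C - Y)"
          by (simp_all add: \<alpha>.measure_Int_Diff[of C Y] \<beta>.measure_Int_Diff[of C Y])
        moreover have "measure \<alpha> (C - Y) \<le> measure \<beta> (C - Y)"
          by (rule neg) auto
        moreover have "B \<inter> Y \<inter> C = C \<inter> Y" "B \<inter> Y - C = (B - C) \<inter> Y" using CB by auto
        then have "measure \<alpha> (B \<inter> Y) = measure \<alpha> (C \<inter> Y) + measure \<alpha> ((B - C) \<inter> Y)"
          "measure \<beta> (B \<inter> Y) = measure \<beta> (C \<inter> Y) + measure \<beta> ((B - C) \<inter> Y)"
          using \<alpha>.measure_Int_Diff[of "B \<inter> Y" C] \<beta>.measure_Int_Diff[of "B \<inter> Y" C] by auto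
        moreover have "measure \<beta> ((B - C) \<inter> Y) \<le> measure \<alpha> ((B - C) \<inter> Y)"
          by (rule pos) auto
        ultimately have "\<nu> C \<le> \<nu> (B \<inter> Y)"
          by (simp add: \<nu>)
        then show "ennreal (\<nu> C) \<le> ennreal (\<nu> (B \<inter> Y))" by (rule ennreal_leI)
      qed
    qed (auto intro!: SUP_upper)
    then show ?thesis
      using that by (simp add: em \<nu> ennreal_minus)
  qed
  have fin: "finite_measure \<alpha>Y" "finite_measure \<beta>Y"
    by (auto intro!: finite_measureI simp: em)
  \<comment> \<open>\<open>measure_of\<close> yields the prescribed values only for a genuine
    measure. Countable additivity of the supremum is inherited from the difference of \<alpha>Y and
    \<beta>Y.\<close>
  have "pos_variation M \<nu> = diff_measure \<alpha>Y \<beta>Y"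
    unfolding pos_variation_def diff_measure_def
    by (simp, intro measure_of_eq sets.space_closed sup) (simp add: sets.sigma_sets_eq)
  also have "emeasure \<dots> A = emeasure \<alpha>Y A - emeasure \<beta>Y A"
    using pos by (intro emeasure_diff_measure fin) (auto simp: em intro!: ennreal_leI)
  finally show ?thesis
    by (simp add: em ennreal_minus)
qed

text \<open>
  No mutual singularity of \<open>\<alpha>\<close> and \<open>\<beta>\<close> is needed: a Hahn decomposition gives
  \<open>\<nu>\<^sup>+ + \<beta> = \<nu>\<^sup>- + \<alpha>\<close> for the Jordan parts \<open>\<nu>\<^sup>+\<close> and \<open>\<nu>\<^sup>-\<close> of \<open>\<nu>\<close>.
\<close>

lemma signed_integral_diff_measures:
  fixes F :: "'a \<Rightarrow> real"
  assumes \<alpha>: "finite_measure \<alpha>" and \<beta>: "finite_measure \<beta>"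
    and [simp]: "sets \<alpha> = sets M" "sets \<beta> = sets M"
    and \<nu>: "\<And>A. A \<in> sets M \<Longrightarrow> \<nu> A = measure \<alpha> A - measure \<beta> A"
    and F [measurable]: "F \<in> borel_measurable M" and bd: "\<And>x. x \<in> space M \<Longrightarrow> \<bar>F x\<bar> \<le> B"
  shows "signed_integral M \<nu> F = (\<integral>x. F x \<partial>\<alpha>) - (\<integral>x. F x \<partial>\<beta>)"
proof -
  interpret \<alpha>: finite_measure \<alpha> by fact
  interpret \<beta>: finite_measure \<beta> by fact
  have [simp]: "space \<alpha> = space M" "space \<beta> = space M"
    by (rule sets_eq_imp_space_eq, simp)+
  obtain Y where Y [measurable]: "Y \<in> sets M"
    and Y1: "\<And>X. X \<in> sets M \<Longrightarrow> X \<subseteq> Y \<Longrightarrow> measure \<beta> X \<le> measure \<alpha> X"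
    and Y2: "\<And>X. X \<in> sets M \<Longrightarrow> X \<inter> Y = {} \<Longrightarrow> measure \<alpha> X \<le> measure \<beta> X"
    using finite_unsigned_Hahn_decomposition[OF \<alpha> \<beta>]
    by (auto simp: \<alpha>.emeasure_eq_measure \<beta>.emeasure_eq_measure)
  have p: "emeasure (pos_variation M \<nu>) A = ennreal (measure \<alpha> (A \<inter> Y) - measure \<beta> (A \<inter> Y))"
    if "A \<in> sets M" for A
    by (rule emeasure_pos_variation[OF \<alpha> \<beta>]) (use \<nu> Y1 Y2 that in auto)
  \<comment> \<open>The negative part of \<nu> is the positive part of \<beta> - \<alpha>, whose
    Hahn set is the complement of \<open>Y\<close>.\<close>
  have n: "emeasure (neg_variation M \<nu>) A = ennreal (measure \<beta> (A - Y) - measure \<alpha> (A - Y))"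
    if A: "A \<in> sets M" for A
  proof -
    have "emeasure (neg_variation M \<nu>) A
        = ennreal (measure \<beta> (A \<inter> (space M - Y)) - measure \<alpha> (A \<inter> (space M - Y)))"
      unfolding neg_variation_def
    proof (rule emeasure_pos_variation[OF \<beta> \<alpha>])
      fix X assume X: "X \<in> sets M" "X \<inter> (space M - Y) = {}"
      then have "X \<subseteq> Y" using sets.sets_into_space by blast
      then show "measure \<beta> X \<le> measure \<alpha> X" using X by (intro Y1)
    qed (use \<nu> A in \<open>auto intro!: Y2\<close>)
    also have "A \<inter> (space M - Y) = A - Y"
      using A sets.sets_into_space by blast
    finally show ?thesis .
  qed
  have "space (pos_variation M \<nu>) = space M" "space (neg_variation M \<nu>) = space M"
    by (rule sets_eq_imp_space_eq, simp)+
  then have fin: "finite_measure (pos_variation M \<nu>)" "finite_measure (neg_variation M \<nu>)"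
    by (auto intro!: finite_measureI simp: p n)
  have int: "integrable K F" if "finite_measure K" "sets K = sets M" for K
    using that bd sets_eq_imp_space_eq[OF that(2)]
    by (intro finite_measure.integrable_const_bound[where B=B] AE_I2) (auto cong: measurable_cong_sets)
  \<comment> \<open>Both sides take the value \<alpha>(A \<inter> Y) + \<beta>(A - Y) on every
    measurable set \<open>A\<close>.\<close>
  have "plus_measure (pos_variation M \<nu>) \<beta> = plus_measure (neg_variation M \<nu>) \<alpha>"
  proof (rule measure_eqI)
    fix A assume "A \<in> sets (plus_measure (pos_variation M \<nu>) \<beta>)"
    then have A [measurable]: "A \<in> sets M" by simp
    have "measure \<alpha> A = measure \<alpha> (A \<inter> Y) + measure \<alpha> (A - Y)"
      "measure \<beta> A = measure \<beta> (A \<inter> Y) + measure \<beta> (A - Y)"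
      by (simp_all add: \<alpha>.measure_Int_Diff[of A Y] \<beta>.measure_Int_Diff[of A Y])
    moreover have "measure \<beta> (A \<inter> Y) \<le> measure \<alpha> (A \<inter> Y)" "measure \<alpha> (A - Y) \<le> measure \<beta> (A - Y)"
      by (auto intro!: Y1 Y2)
    ultimately show "emeasure (plus_measure (pos_variation M \<nu>) \<beta>) A
        = emeasure (plus_measure (neg_variation M \<nu>) \<alpha>) A"
      by (simp add: emeasure_plus_measure p n \<alpha>.emeasure_eq_measure \<beta>.emeasure_eq_measure
          flip: ennreal_plus)
  qed simp
  then have "(\<integral>x. F x \<partial>plus_measure (pos_variation M \<nu>) \<beta>)
      = (\<integral>x. F x \<partial>plus_measure (neg_variation M \<nu>) \<alpha>)" by simp
  then show ?thesis
    by (simp add: integral_plus_measure int fin \<alpha> \<beta> signed_integral_def)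
qed

section \<open>Densities with respect to a signed measure\<close>

text \<open>
  With \<open>P\<close> and \<open>N\<close> the Jordan parts of \<open>\<nu>\<close>, the signed measure \<open>f\<nu>\<close> is the difference of the finite
  measures \<open>f\<^sup>+P + f\<^sup>-N\<close> and \<open>f\<^sup>-P + f\<^sup>+N\<close>. This holds whether or not \<open>P\<close> and \<open>N\<close> are finite.
\<close>

lemma signed_integral_signed_density:
  fixes f F :: "'a \<Rightarrow> real"
  assumes f: "signed_integrable M \<nu> f"
    and F [measurable]: "F \<in> borel_measurable M" and bd: "\<And>x. x \<in> space M \<Longrightarrow> \<bar>F x\<bar> \<le> B"
  shows "signed_integral M (signed_density M \<nu> f) F = signed_integral M \<nu> (\<lambda>x. F x * f x)"
proof -
  define P where "P = pos_variation M \<nu>"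
  define N where "N = neg_variation M \<nu>"
  have [simp]: "sets P = sets M" "sets N = sets M"
    by (simp_all add: P_def N_def)
  have sp: "space K = space M" if "sets K = sets M" for K :: "'a measure"
    using that by (rule sets_eq_imp_space_eq)
  have [measurable_cong]: "sets P = sets M" "sets N = sets M" by simp_all
  have fP: "integrable P f" and fN: "integrable N f"
    using f by (auto simp: signed_integrable_def P_def N_def)
  have [measurable]: "f \<in> borel_measurable M"
    using borel_measurable_integrable[OF fP] by (simp cong: measurable_cong_sets)
  \<comment> \<open>The measure with density the positive part of \<open>g\<close>. Taking
    \<open>f\<close> and \<open>- f\<close> for \<open>g\<close> produces the positive and negative
    parts of \<open>f\<close> times \<open>K\<close>.\<close>
  define D where "D K g = density K (\<lambda>x. ennreal (max 0 (g x)))" for K :: "'a measure" and g :: "'a \<Rightarrow> real"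
  have sD [simp]: "sets (D K g) = sets M" if "sets K = sets M" for K g
    using that by (simp add: D_def)
  have D: "finite_measure (D K g)"
    "\<And>A. A \<in> sets M \<Longrightarrow> measure (D K g) A = (\<integral>x. indicator A x * max 0 (g x) \<partial>K)"
    "(\<integral>x. F x \<partial>D K g) = (\<integral>x. F x * max 0 (g x) \<partial>K)"
    "integrable (D K g) F"
    if K [simp]: "sets K = sets M" and g: "integrable K g" for K g
  proof -
    have [measurable_cong]: "sets K = sets M" by simp
    have [measurable]: "g \<in> borel_measurable M"
      using borel_measurable_integrable[OF g] by (simp cong: measurable_cong_sets)
    have g': "integrable K (\<lambda>x. max 0 (g x))" using g by simp
    have e: "emeasure (D K g) A = ennreal (\<integral>x. indicator A x * max 0 (g x) \<partial>K)"
      if [measurable]: "A \<in> sets M" for A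
    proof -
      have "integrable K (\<lambda>x. indicator A x * max 0 (g x))"
        using integrable_mult_indicator[OF _ g', of A] by simp
      then show ?thesis unfolding D_def
        by (subst emeasure_density; simp add: nn_integral_eq_integral[symmetric])
           (auto intro!: nn_integral_cong simp: indicator_def)
    qed
    show fin: "finite_measure (D K g)" by (rule finite_measureI) (simp add: e[OF sets.top] sp[of "D K g"])
    show "measure (D K g) A = (\<integral>x. indicator A x * max 0 (g x) \<partial>K)" if "A \<in> sets M" for A
      unfolding measure_def e[OF that] by (simp add: integral_nonneg_AE)
    show "(\<integral>x. F x \<partial>D K g) = (\<integral>x. F x * max 0 (g x) \<partial>K)"
      unfolding D_def by (subst integral_density) (auto simp: mult.commute)
    show "integrable (D K g) F"
      using fin bd sp[of "D K g"]
      by (intro finite_measure.integrable_const_bound[where B=B] AE_I2) (auto cong: measurable_cong_sets)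
  qed
  have fm: "integrable P (\<lambda>x. - f x)" "integrable N (\<lambda>x. - f x)" using fP fN by auto
  \<comment> \<open>In each of the two lists the facts 1 to 4 concern \<open>f\<close> and the facts
    5 to 8 concern \<open>- f\<close>.\<close>
  note DP = D[OF \<open>sets P = sets M\<close> fP] D[OF \<open>sets P = sets M\<close> fm(1)]
  note DN = D[OF \<open>sets N = sets M\<close> fN] D[OF \<open>sets N = sets M\<close> fm(2)]
  define \<alpha> where "\<alpha> = plus_measure (D P f) (D N (\<lambda>x. - f x))"
  define \<beta> where "\<beta> = plus_measure (D P (\<lambda>x. - f x)) (D N f)"
  have fin: "finite_measure \<alpha>" "finite_measure \<beta>"
    unfolding \<alpha>_def \<beta>_def by (auto intro!: finite_measure_plus_measure DP DN)
  \<comment> \<open>Used twice: with \<open>G\<close> an indicator it identifies \<alpha> - \<beta>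
    as the signed density, and with \<open>G = F\<close> it evaluates the final integrals.\<close>
  have split: "(\<integral>x. G x * max 0 (f x) \<partial>K) - (\<integral>x. G x * max 0 (- f x) \<partial>K) = (\<integral>x. G x * f x \<partial>K)"
    if K [simp]: "sets K = sets M" and f: "integrable K f" and G: "G \<in> borel_measurable M"
      and C: "\<And>x. x \<in> space M \<Longrightarrow> \<bar>G x\<bar> \<le> C" for K G C
  proof -
    have [measurable_cong]: "sets K = sets M" by simp
    note [measurable] = G
    have i: "integrable K (\<lambda>x. G x * h x)" if h: "integrable K h" for h
    proof (rule Bochner_Integration.integrable_bound)
      show "integrable K (\<lambda>x. C * h x)" using h by simp
      have [measurable]: "h \<in> borel_measurable M"
        using borel_measurable_integrable[OF h] by (simp cong: measurable_cong_sets)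
      show "(\<lambda>x. G x * h x) \<in> borel_measurable K" by measurable
      show "AE x in K. norm (G x * h x) \<le> norm (C * h x)"
        using C sp[OF K] by (intro AE_I2) (fastforce simp: abs_mult intro: mult_right_mono)
    qed
    have "integrable K (\<lambda>x. max 0 (f x))" "integrable K (\<lambda>x. max 0 (- f x))"
      using f by simp_all
    from Bochner_Integration.integral_diff[OF i[OF this(1)] i[OF this(2)]]
    have "(\<integral>x. G x * max 0 (f x) \<partial>K) - (\<integral>x. G x * max 0 (- f x) \<partial>K)
        = (\<integral>x. G x * max 0 (f x) - G x * max 0 (- f x) \<partial>K)" ..
    also have "\<dots> = (\<integral>x. G x * f x \<partial>K)"
      by (intro Bochner_Integration.integral_cong) (auto simp: max_def)
    finally show ?thesis .
  qed
  have meas: "measure \<alpha> A = measure (D P f) A + measure (D N (\<lambda>x. - f x)) A"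
    "measure \<beta> A = measure (D P (\<lambda>x. - f x)) A + measure (D N f) A" if "A \<in> sets M" for A
    unfolding \<alpha>_def \<beta>_def measure_def using that DP(1,5) DN(1,5)
    by (auto simp: emeasure_plus_measure finite_measure.emeasure_finite less_top[symmetric]
        intro!: enn2real_plus)
  have "signed_density M \<nu> f A = measure \<alpha> A - measure \<beta> A" if [measurable]: "A \<in> sets M" for A
  proof -
    from split[OF _ fP, of "indicat_real A" 1] split[OF _ fN, of "indicat_real A" 1]
    show ?thesis
      by (simp add: meas DP DN signed_density_def signed_integral_def flip: P_def N_def)
  qed
  then have "signed_integral M (signed_density M \<nu> f) F = (\<integral>x. F x \<partial>\<alpha>) - (\<integral>x. F x \<partial>\<beta>)"
    by (intro signed_integral_diff_measures[where B=B] fin F bd) (simp_all add: \<alpha>_def \<beta>_def)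
  also have "\<dots> = signed_integral M \<nu> (\<lambda>x. F x * f x)"
    using split[OF _ fP F bd] split[OF _ fN F bd]
    by (simp add: \<alpha>_def \<beta>_def integral_plus_measure DP DN signed_integral_def flip: P_def N_def)
  finally show ?thesis .
qed

text \<open>For each Jordan part separately, dominated convergence with the bound
  \<open>norm (f x)\<close> applies to the indicators of the partial unions. The two series are then
  subtracted.\<close>

lemma vector_measure_signed_density:
  fixes f :: "'a \<Rightarrow> 'b::{banach, second_countable_topology}"
  assumes "signed_integrable M \<nu> f"
  shows "vector_measure M (signed_density M \<nu> f)"
  unfolding vector_measure_def
proof (intro allI impI)
  fix A :: "nat \<Rightarrow> 'a set" assume A: "range A \<subseteq> sets M" and disj: "disjoint_family A"
  have "(\<lambda>n. \<integral>x. indicat_real (A n) x *\<^sub>R f x \<partial>K) sums (\<integral>x. indicat_real (\<Union>n. A n) x *\<^sub>R f x \<partial>K)"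
    if K [measurable_cong]: "sets K = sets M" and f: "integrable K f" for K
  proof -
    have [measurable]: "A n \<in> sets M" for n using A by auto
    have [measurable]: "f \<in> borel_measurable K" using f by simp
    have "(\<lambda>n. \<integral>x. indicat_real (\<Union>i<n. A i) x *\<^sub>R f x \<partial>K)
        \<longlonglongrightarrow> (\<integral>x. indicat_real (\<Union>n. A n) x *\<^sub>R f x \<partial>K)"
    proof (rule integral_dominated_convergence[where w="\<lambda>x. norm (f x)"])
      show "integrable K (\<lambda>x. norm (f x))" using f by simp
      show "AE x in K. (\<lambda>n. indicat_real (\<Union>i<n. A i) x *\<^sub>R f x) \<longlonglongrightarrow> indicat_real (\<Union>n. A n) x *\<^sub>R f x"
        by (intro AE_I2 tendsto_intros LIMSEQ_indicator_UN)
    qed (auto simp: indicator_def)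
    moreover have "(\<integral>x. indicat_real (\<Union>i<n. A i) x *\<^sub>R f x \<partial>K)
        = (\<Sum>i<n. \<integral>x. indicat_real (A i) x *\<^sub>R f x \<partial>K)" for n
    proof -
      have "integrable K (\<lambda>x. indicat_real (A i) x *\<^sub>R f x)" for i
        using f by (intro integrable_mult_indicator) (simp_all add: K)
      then have "(\<Sum>i<n. \<integral>x. indicat_real (A i) x *\<^sub>R f x \<partial>K)
          = (\<integral>x. (\<Sum>i<n. indicat_real (A i) x *\<^sub>R f x) \<partial>K)"
        by (subst Bochner_Integration.integral_sum) auto
      also have "(\<lambda>x. \<Sum>i<n. indicat_real (A i) x *\<^sub>R f x) = (\<lambda>x. indicat_real (\<Union>i<n. A i) x *\<^sub>R f x)"
        using disj by (subst indicator_UN_disjoint)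
          (auto simp: scaleR_sum_left disjoint_family_on_def)
      finally show ?thesis by simp
    qed
    ultimately show ?thesis
      by (simp add: sums_def)
  qed
  then show "(\<lambda>n. signed_density M \<nu> f (A n)) sums signed_density M \<nu> f (\<Union>n. A n)"
    using assms by (auto simp: signed_density_def signed_integral_def signed_integrable_def intro!: sums_diff)
qed

section \<open>Pairings with vector-valued densities\<close>

lemma signed_integral_cong:
  assumes "\<And>A. A \<in> sets M \<Longrightarrow> \<nu> A = \<nu>' A" and "\<And>x. x \<in> space M \<Longrightarrow> f x = g x"
  shows "signed_integral M \<nu> f = signed_integral M \<nu>' g"
proof -
  have "pos_variation M \<nu> = pos_variation M \<nu>'" "neg_variation M \<nu> = neg_variation M \<nu>'"
    unfolding neg_variation_def using assms(1) by (auto intro!: pos_variation_cong)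
  moreover have "integral\<^sup>L K f = integral\<^sup>L K g" if "sets K = sets M" for K
    using assms(2) sets_eq_imp_space_eq[OF that] by (intro Bochner_Integration.integral_cong) auto
  ultimately show ?thesis
    by (simp add: signed_integral_def)
qed

lemma vector_pairing_cong:
  assumes "\<And>x. x \<in> space M \<Longrightarrow> F x = G x"
  shows "vector_pairing M F E = vector_pairing M G E"
  unfolding vector_pairing_def by (intro sum.cong signed_integral_cong) (simp_all add: assms)

text \<open>Every component of the density has its own Jordan decomposition. The scalar case brings
  each of them back to the Jordan parts of \<nu>, after which the components can be summed under one
  integral.\<close>

lemma vector_pairing_signed_density:
  fixes f F :: "'a \<Rightarrow> 'b::euclidean_space"
  assumes f: "signed_integrable M \<nu> f"
    and F: "\<And>b. b \<in> Basis \<Longrightarrow> (\<lambda>x. F x \<bullet> b) \<in> borel_measurable M"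
    and bd: "\<And>b. b \<in> Basis \<Longrightarrow> \<exists>B. \<forall>x\<in>space M. \<bar>F x \<bullet> b\<bar> \<le> B"
  shows "vector_pairing M F (signed_density M \<nu> f) = signed_integral M \<nu> (\<lambda>x. F x \<bullet> f x)"
proof -
  have fb: "signed_integrable M \<nu> (\<lambda>x. f x \<bullet> b)" for b
    using f by (simp add: signed_integrable_def)
  have comp: "signed_density M \<nu> f A \<bullet> b = signed_density M \<nu> (\<lambda>x. f x \<bullet> b) A"
    if A: "A \<in> sets M" for A b
  proof -
    have "integrable K (\<lambda>x. indicat_real A x *\<^sub>R f x)" if "sets K = sets M" "integrable K f" for K
      using that A by (intro integrable_mult_indicator) auto
    then show ?thesis
      using f by (simp add: signed_density_def signed_integral_def signed_integrable_def
          inner_diff_left flip: integral_inner_left)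
  qed
  have int: "integrable K (\<lambda>x. (F x \<bullet> b) * (f x \<bullet> b))"
    if K: "sets K = sets M" and fK: "integrable K f" and b: "b \<in> Basis" for K b
  proof -
    obtain B where B: "\<And>x. x \<in> space M \<Longrightarrow> \<bar>F x \<bullet> b\<bar> \<le> B" using bd[OF b] by blast
    have [measurable]: "(\<lambda>x. F x \<bullet> b) \<in> borel_measurable K" "f \<in> borel_measurable K"
      using F[OF b] K fK by (auto cong: measurable_cong_sets)
    show ?thesis
    proof (rule Bochner_Integration.integrable_bound)
      show "integrable K (\<lambda>x. B * (f x \<bullet> b))" using fK by simp
      show "AE x in K. norm ((F x \<bullet> b) * (f x \<bullet> b)) \<le> norm (B * (f x \<bullet> b))"
        using B sets_eq_imp_space_eq[OF K]
        by (intro AE_I2) (fastforce simp: abs_mult intro: mult_right_mono)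
    qed measurable
  qed
  have "vector_pairing M F (signed_density M \<nu> f)
      = (\<Sum>b\<in>Basis. signed_integral M \<nu> (\<lambda>x. (F x \<bullet> b) * (f x \<bullet> b)))"
    unfolding vector_pairing_def
  proof (rule sum.cong)
    fix b :: 'b assume b: "b \<in> Basis"
    obtain B where B: "\<And>x. x \<in> space M \<Longrightarrow> \<bar>F x \<bullet> b\<bar> \<le> B" using bd[OF b] by blast
    \<comment> \<open>Taking a component commutes with forming the density on measurable sets, and
      the signed integral sees no other sets.\<close>
    have "signed_integral M (\<lambda>A. signed_density M \<nu> f A \<bullet> b) (\<lambda>x. F x \<bullet> b)
        = signed_integral M (signed_density M \<nu> (\<lambda>x. f x \<bullet> b)) (\<lambda>x. F x \<bullet> b)"
      by (intro signed_integral_cong comp) simp_all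
    also have "\<dots> = signed_integral M \<nu> (\<lambda>x. (F x \<bullet> b) * (f x \<bullet> b))"
      by (rule signed_integral_signed_density[OF fb F[OF b] B])
    finally show "signed_integral M (\<lambda>A. signed_density M \<nu> f A \<bullet> b) (\<lambda>x. F x \<bullet> b)
        = signed_integral M \<nu> (\<lambda>x. (F x \<bullet> b) * (f x \<bullet> b))" .
  qed simp
  also have "\<dots> = signed_integral M \<nu> (\<lambda>x. F x \<bullet> f x)"
  proof -
    have "(\<Sum>b\<in>Basis. integral\<^sup>L K (\<lambda>x. (F x \<bullet> b) * (f x \<bullet> b))) = integral\<^sup>L K (\<lambda>x. F x \<bullet> f x)"
      if "sets K = sets M" "integrable K f" for K
      unfolding euclidean_inner[of "F x" "f x" for x]
      by (rule Bochner_Integration.integral_sum[symmetric]) (rule int[OF that])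
    then show ?thesis
      using f by (simp add: signed_integral_def signed_integrable_def sum_subtractf)
  qed
  finally show ?thesis .
qed

subsection \<open>Symmetry of second derivatives\<close>

text \<open>On an open set the derivative depends only on values in the set, so agreement on
  \<open>S\<close> passes to all derivatives by induction on \<open>r\<close>.\<close>

lemma class_C_on_cong:
  assumes "open S" and "\<And>p. p \<in> S \<Longrightarrow> f p = g p" and "class_C_on r S f"
  shows "class_C_on r S g"
  using assms(2,3)
proof (induction r arbitrary: f g)
  case 0
  then show ?case by (simp cong: continuous_on_cong)
next
  case (Suc r)
  have "g differentiable (at p)" if "p \<in> S" for p
    using Suc.prems that assms(1)
    by (metis class_C_on.simps(2) differentiable_def has_derivative_transform_within_open)
  moreover have "class_C_on r S (\<lambda>p. frechet_derivative g (at p) v)" for v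
  proof (rule Suc.IH)
    show "class_C_on r S (\<lambda>p. frechet_derivative f (at p) v)" using Suc.prems by simp
    show "frechet_derivative f (at p) v = frechet_derivative g (at p) v" if "p \<in> S" for p
      using Suc.prems that assms(1)
      by (metis class_C_on.simps(2) frechet_derivative_transform_within_open)
  qed
  ultimately show ?case by simp
qed

lemma has_derivative_vec_lambda:
  fixes f :: "'n::finite \<Rightarrow> 'a::real_normed_vector \<Rightarrow> real"
  assumes "\<And>i. (f i has_derivative f' i) (at x within S)"
  shows "((\<lambda>p. \<chi> i. f i p) has_derivative (\<lambda>v. \<chi> i. f' i v)) (at x within S)"
  using assms
  by (subst has_derivative_componentwise_within) (auto simp: Basis_vec_def inner_axis)

lemma frechet_derivative_vec_lambda:
  fixes f :: "'n::finite \<Rightarrow> 'a::real_normed_vector \<Rightarrow> real"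
  assumes "\<And>i. f i differentiable (at p)"
  shows "frechet_derivative (\<lambda>p. \<chi> i. f i p) (at p) v = (\<chi> i. frechet_derivative (f i) (at p) v)"
  using has_derivative_vec_lambda[of f "\<lambda>i. frechet_derivative (f i) (at p)" p UNIV] assms
  by (metis frechet_derivative_at frechet_derivative_works)

text \<open>Induction on \<open>r\<close>. The derivative of the vector is identified with the
  vector of derivatives only on \<open>S\<close>, where the components are differentiable; locality
  carries the class across.\<close>

lemma class_C_on_vec_lambda:
  fixes f :: "'n::finite \<Rightarrow> 'a::euclidean_space \<Rightarrow> real"
  assumes "open S" and "\<And>i. class_C_on r S (f i)"
  shows "class_C_on r S (\<lambda>p. \<chi> i. f i p)"
  using assms(2)
proof (induction r arbitrary: f)
  case 0
  then show ?case by (simp add: continuous_on_vec_lambda)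
next
  case (Suc r)
  have der: "((\<lambda>p. \<chi> i. f i p) has_derivative (\<lambda>v. \<chi> i. frechet_derivative (f i) (at p) v)) (at p)"
    if "p \<in> S" for p
    by (intro has_derivative_vec_lambda) (use Suc.prems that in \<open>simp add: frechet_derivative_works\<close>)
  have "class_C_on r S (\<lambda>p. frechet_derivative (\<lambda>p. \<chi> i. f i p) (at p) v)" for v
  proof (rule class_C_on_cong[OF assms(1)])
    show "class_C_on r S (\<lambda>p. \<chi> i. frechet_derivative (f i) (at p) v)"
      using Suc.prems by (intro Suc.IH) simp
    show "(\<chi> i. frechet_derivative (f i) (at p) v) = frechet_derivative (\<lambda>p. \<chi> i. f i p) (at p) v"
      if "p \<in> S" for p
      using Suc.prems that by (simp add: frechet_derivative_vec_lambda)
  qed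
  with der show ?case by (auto simp: differentiable_def)
qed

section \<open>Second differences and mixed derivatives\<close>

text \<open>Two applications of the mean value theorem, first along \<open>v\<close> to the
  increment of \<open>f\<close> in direction \<open>w\<close>, then along \<open>w\<close> to the
  derivative in direction \<open>v\<close>.\<close>

lemma second_difference_mvt:
  fixes f :: "'a::euclidean_space \<Rightarrow> real"
  assumes f: "class_C_on 2 S f" and h: "0 < h"
    and S: "\<And>s t. 0 \<le> s \<Longrightarrow> s \<le> h \<Longrightarrow> 0 \<le> t \<Longrightarrow> t \<le> h \<Longrightarrow> p + s *\<^sub>R v + t *\<^sub>R w \<in> S"
  obtains s t where "0 < s" "s < h" "0 < t" "t < h"
    and "f (p + h *\<^sub>R v + h *\<^sub>R w) - f (p + h *\<^sub>R v) - f (p + h *\<^sub>R w) + f p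
      = h * h * frechet_derivative (\<lambda>q. frechet_derivative f (at q) v) (at (p + s *\<^sub>R v + t *\<^sub>R w)) w"
proof -
  let ?D = "\<lambda>q. frechet_derivative f (at q) v"
  have d1: "(f has_derivative frechet_derivative f (at q)) (at q)" if "q \<in> S" for q
    using f that by (simp add: numeral_2_eq_2 frechet_derivative_works)
  have d2: "(?D has_derivative frechet_derivative ?D (at q)) (at q)" if "q \<in> S" for q
    using f that by (simp add: numeral_2_eq_2 frechet_derivative_works)
  have 1: "((\<lambda>s. f (p + s *\<^sub>R v + t *\<^sub>R w)) has_real_derivative ?D (p + s *\<^sub>R v + t *\<^sub>R w)) (at s)"
    if "0 \<le> s" "s \<le> h" "0 \<le> t" "t \<le> h" for s t
  proof -
    have "((\<lambda>s. p + s *\<^sub>R v + t *\<^sub>R w) has_derivative (\<lambda>x. x *\<^sub>R v)) (at s)"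
      by (auto intro!: derivative_eq_intros)
    from has_derivative_compose[OF this d1[OF S[OF that]]] show ?thesis
      using linear_cmul[OF has_derivative_linear[OF d1[OF S[OF that]]]]
      by (simp add: has_field_derivative_def mult.commute[of _ "?D _"] mult_commute_abs)
  qed
  have 2: "((\<lambda>t. ?D (p + s *\<^sub>R v + t *\<^sub>R w)) has_real_derivative
      frechet_derivative ?D (at (p + s *\<^sub>R v + t *\<^sub>R w)) w) (at t)"
    if "0 \<le> s" "s \<le> h" "0 \<le> t" "t \<le> h" for s t
  proof -
    have "((\<lambda>t. p + s *\<^sub>R v + t *\<^sub>R w) has_derivative (\<lambda>x. x *\<^sub>R w)) (at t)"
      by (auto intro!: derivative_eq_intros)
    from has_derivative_compose[OF this d2[OF S[OF that]]] show ?thesis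
      using linear_cmul[OF has_derivative_linear[OF d2[OF S[OF that]]]]
      by (simp add: has_field_derivative_def mult_commute_abs)
  qed
  \<comment> \<open>The zero multiples of \<open>v\<close> and \<open>w\<close> are written out so
    that the endpoint values are literal instances of the function of \<open>s\<close>.\<close>
  have "\<exists>s. 0 < s \<and> s < h \<and>
      (f (p + h *\<^sub>R v + h *\<^sub>R w) - f (p + h *\<^sub>R v + 0 *\<^sub>R w)) - (f (p + 0 *\<^sub>R v + h *\<^sub>R w) - f (p + 0 *\<^sub>R v + 0 *\<^sub>R w))
      = (h - 0) * (?D (p + s *\<^sub>R v + h *\<^sub>R w) - ?D (p + s *\<^sub>R v + 0 *\<^sub>R w))"
    by (rule MVT2[OF h, of "\<lambda>s. f (p + s *\<^sub>R v + h *\<^sub>R w) - f (p + s *\<^sub>R v + 0 *\<^sub>R w)"])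
       (use h in \<open>auto intro!: DERIV_diff 1 1[where t=0, simplified]\<close>)
  then obtain s where s: "0 < s" "s < h" and
    e1: "f (p + h *\<^sub>R v + h *\<^sub>R w) - f (p + h *\<^sub>R v) - (f (p + h *\<^sub>R w) - f p)
      = h * (?D (p + s *\<^sub>R v + h *\<^sub>R w) - ?D (p + s *\<^sub>R v))"
    by auto
  have "\<exists>t. 0 < t \<and> t < h \<and> ?D (p + s *\<^sub>R v + h *\<^sub>R w) - ?D (p + s *\<^sub>R v + 0 *\<^sub>R w)
      = (h - 0) * frechet_derivative ?D (at (p + s *\<^sub>R v + t *\<^sub>R w)) w"
    by (rule MVT2[OF h, of "\<lambda>t. ?D (p + s *\<^sub>R v + t *\<^sub>R w)"]) (use s in \<open>auto intro!: 2\<close>)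
  then obtain t where t: "0 < t" "t < h" and
    e2: "?D (p + s *\<^sub>R v + h *\<^sub>R w) - ?D (p + s *\<^sub>R v)
      = h * frechet_derivative ?D (at (p + s *\<^sub>R v + t *\<^sub>R w)) w"
    by auto
  show ?thesis
    by (rule that[OF s t]) (use e1 e2 in \<open>simp add: algebra_simps\<close>)
qed

text \<open>Both iterated derivatives are limits of the same second difference quotient.\<close>

lemma frechet_derivative_symmetric:
  fixes f :: "'a::euclidean_space \<Rightarrow> real"
  assumes "open S" and f: "class_C_on 2 S f" and "p \<in> S"
  shows "frechet_derivative (\<lambda>q. frechet_derivative f (at q) v) (at p) w
    = frechet_derivative (\<lambda>q. frechet_derivative f (at q) w) (at p) v"
proof -
  define A where "A v w q = frechet_derivative (\<lambda>q. frechet_derivative f (at q) v) (at q) w" for v w q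
  have cont: "isCont (A v w) p" for v w
  proof -
    have "continuous_on S (A v w)"
      using f unfolding A_def by (simp add: numeral_2_eq_2)
    then show ?thesis using assms continuous_on_eq_continuous_at by blast
  qed
  have "\<bar>A v w p - A w v p\<bar> < \<epsilon>" if \<epsilon>: "0 < \<epsilon>" for \<epsilon>
  proof -
    obtain d1 where d1: "0 < d1" "\<And>q. dist q p < d1 \<Longrightarrow> \<bar>A v w q - A v w p\<bar> < \<epsilon> / 2"
      using cont[of v w] half_gt_zero[OF \<epsilon>] unfolding continuous_at_eps_delta dist_real_def by blast
    obtain d2 where d2: "0 < d2" "\<And>q. dist q p < d2 \<Longrightarrow> \<bar>A w v q - A w v p\<bar> < \<epsilon> / 2"
      using cont[of w v] half_gt_zero[OF \<epsilon>] unfolding continuous_at_eps_delta dist_real_def by blast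
    obtain d3 where d3: "0 < d3" "\<And>q. dist q p < d3 \<Longrightarrow> q \<in> S"
      using assms(1,3) open_dist by blast
    define d where "d = min d1 (min d2 d3)"
    \<comment> \<open>Small enough for the whole parallelogram spanned by
      \<open>h *\<^sub>R v\<close> and \<open>h *\<^sub>R w\<close> at \<open>p\<close> to lie
      within distance \<open>d\<close> of \<open>p\<close>. The summand 1 covers the case that
      \<open>v\<close> and \<open>w\<close> both vanish.\<close>
    define h where "h = d / (2 * (norm v + norm w + 1))"
    have d: "0 < d" using d1 d2 d3 by (simp add: d_def)
    have den: "0 < 2 * (norm v + norm w + 1)"
      by (smt (verit) norm_ge_zero)
    have h: "0 < h" using d den by (simp add: h_def)
    have near: "dist (p + s *\<^sub>R v + t *\<^sub>R w) p < d" if "0 \<le> s" "s \<le> h" "0 \<le> t" "t \<le> h" for s t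
    proof -
      have "dist (p + s *\<^sub>R v + t *\<^sub>R w) p = norm (s *\<^sub>R v + t *\<^sub>R w)"
        by (simp add: dist_norm add.assoc)
      also have "\<dots> \<le> s * norm v + t * norm w"
        using that by (intro norm_triangle_le) simp
      also have "\<dots> \<le> h * norm v + h * norm w"
        using that by (intro add_mono mult_right_mono) auto
      also have "\<dots> < h * (2 * (norm v + norm w + 1))"
        using h by (simp add: algebra_simps) (smt (verit) mult_nonneg_nonneg norm_ge_zero)
      also have "\<dots> = d" using den by (simp add: h_def)
      finally show ?thesis .
    qed
    obtain s t where st: "0 < s" "s < h" "0 < t" "t < h"
      and 1: "f (p + h *\<^sub>R v + h *\<^sub>R w) - f (p + h *\<^sub>R v) - f (p + h *\<^sub>R w) + f p
        = h * h * A v w (p + s *\<^sub>R v + t *\<^sub>R w)"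
      using second_difference_mvt[OF f h, of p v w] near d3 unfolding A_def d_def
      by (metis min_less_iff_conj)
    have near': "dist (p + s *\<^sub>R w + t *\<^sub>R v) p < d" if "0 \<le> s" "s \<le> h" "0 \<le> t" "t \<le> h" for s t
      using near[of t s] that by (simp add: add.commute add.left_commute)
    obtain s' t' where st': "0 < s'" "s' < h" "0 < t'" "t' < h"
      and 2: "f (p + h *\<^sub>R w + h *\<^sub>R v) - f (p + h *\<^sub>R w) - f (p + h *\<^sub>R v) + f p
        = h * h * A w v (p + s' *\<^sub>R w + t' *\<^sub>R v)"
      using second_difference_mvt[OF f h, of p w v] near' d3 unfolding A_def d_def
      by (metis min_less_iff_conj)
    \<comment> \<open>The second difference is unchanged when \<open>v\<close> and \<open>w\<close>
      are exchanged, and \<open>h * h\<close> cancels since \<open>h\<close> is positive.\<close>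
    have "p + h *\<^sub>R v + h *\<^sub>R w = p + h *\<^sub>R w + h *\<^sub>R v" by simp
    with 1 2 h have "A v w (p + s *\<^sub>R v + t *\<^sub>R w) = A w v (p + s' *\<^sub>R w + t' *\<^sub>R v)"
      by (smt (verit) mult_cancel_left mult_eq_0_iff)
    moreover have "\<bar>A v w (p + s *\<^sub>R v + t *\<^sub>R w) - A v w p\<bar> < \<epsilon> / 2"
      using near[of s t] st by (intro d1) (simp add: d_def)
    moreover have "\<bar>A w v (p + s' *\<^sub>R w + t' *\<^sub>R v) - A w v p\<bar> < \<epsilon> / 2"
      using near'[of s' t'] st' by (intro d2) (simp add: d_def)
    ultimately show ?thesis by linarith
  qed
  then have "A v w p = A w v p"
    by (metis less_irrefl right_minus_eq zero_less_abs_iff)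
  then show ?thesis by (simp add: A_def)
qed

subsection \<open>Test functions\<close>

text \<open>\<open>\<Omega> - K\<close> is open, so \<phi> vanishes on a whole neighbourhood of the
  point.\<close>

lemma frechet_derivative_outside_support:
  fixes \<phi> :: "(real^'d) \<times> (real^'s) \<Rightarrow> 'b::real_normed_vector"
  assumes "open \<Omega>" "compact K" and 0: "\<And>x z. x \<in> \<Omega> - K \<Longrightarrow> \<phi> (x, z) = 0"
    and x: "x \<in> \<Omega> - K"
  shows "frechet_derivative \<phi> (at (x, z)) v = 0"
proof -
  have "open ((\<Omega> - K) \<times> (UNIV :: (real^'s) set))"
    using assms by (intro open_Times open_Diff compact_imp_closed) auto
  then have "(\<phi> has_derivative (\<lambda>_. 0)) (at (x, z))"
    using x 0 by (intro has_derivative_transform_within_open[OF has_derivative_const]) auto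
  then show ?thesis by (metis frechet_derivative_at)
qed

text \<open>The compact set that works for \<phi> also works for its derivative.\<close>

lemma test_functions_frechet_derivative:
  assumes "open \<Omega>" and \<phi>: "\<phi> \<in> test_functions (Suc r) \<Omega>"
  shows "(\<lambda>p. frechet_derivative \<phi> (at p) v) \<in> test_functions r \<Omega>"
proof -
  obtain K where K: "compact K" "K \<subseteq> \<Omega>" "\<forall>x\<in>\<Omega> - K. \<forall>z. \<phi> (x, z) = 0"
    using \<phi> by (auto simp: test_functions_def)
  have "class_C_on r (\<Omega> \<times> UNIV) (\<lambda>p. frechet_derivative \<phi> (at p) v)"
    using \<phi> unfolding test_functions_def class_C_on.simps by blast
  moreover have "frechet_derivative \<phi> (at (x, z)) v = 0" if "x \<in> \<Omega> - K" for x z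
    by (rule frechet_derivative_outside_support[OF assms(1) K(1) _ that]) (use K(3) in blast)
  ultimately show ?thesis
    using K unfolding test_functions_def by blast
qed

text \<open>The union of the finitely many compact sets belonging to the components serves the
  vector.\<close>

lemma test_functions_vec_lambda:
  fixes f :: "'n::finite \<Rightarrow> (real^'d) \<times> (real^'s) \<Rightarrow> real"
  assumes "open \<Omega>" and f: "\<And>i. f i \<in> test_functions r \<Omega>"
  shows "(\<lambda>p. \<chi> i. f i p) \<in> test_functions r \<Omega>"
proof -
  have "\<forall>i. \<exists>K. compact K \<and> K \<subseteq> \<Omega> \<and> (\<forall>x\<in>\<Omega> - K. \<forall>z. f i (x, z) = 0)"
    using f by (auto simp: test_functions_def)
  then obtain K where K: "\<And>i. compact (K i)" "\<And>i. K i \<subseteq> \<Omega>"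
    "\<And>i x z. x \<in> \<Omega> - K i \<Longrightarrow> f i (x, z) = 0" by metis
  have "compact (\<Union>i. K i)" using K by (intro compact_UN) auto
  moreover have "class_C_on r (\<Omega> \<times> UNIV) (\<lambda>p. \<chi> i. f i p)"
    using f assms(1) by (intro class_C_on_vec_lambda open_Times) (auto simp: test_functions_def)
  ultimately show ?thesis
    using K unfolding test_functions_def
    by (intro CollectI conjI exI[of _ "\<Union>i. K i"]) (auto simp: vec_eq_iff)
qed

text \<open>\<phi> is continuous on the compact set \<open>K \<times> \<Gamma>\<close> and zero on
  the rest of \<open>\<Omega> \<times> \<Gamma>\<close>.\<close>

lemma test_functions_bounded:
  fixes \<phi> :: "(real^'d) \<times> (real^'s) \<Rightarrow> real"
  assumes "\<phi> \<in> test_functions 0 \<Omega>" and "compact \<Gamma>"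
  obtains B where "\<And>p. p \<in> \<Omega> \<times> \<Gamma> \<Longrightarrow> \<bar>\<phi> p\<bar> \<le> B"
proof -
  obtain K where K: "compact K" "K \<subseteq> \<Omega>" "\<forall>x\<in>\<Omega> - K. \<forall>z. \<phi> (x, z) = 0"
    and c: "continuous_on (\<Omega> \<times> UNIV) \<phi>"
    using assms by (auto simp: test_functions_def)
  have "compact (\<phi> ` (K \<times> \<Gamma>))"
    using K assms(2) by (intro compact_continuous_image compact_Times continuous_on_subset[OF c]) auto
  then obtain B where B: "\<And>y. y \<in> \<phi> ` (K \<times> \<Gamma>) \<Longrightarrow> \<bar>y\<bar> \<le> B"
    using compact_imp_bounded by (force simp: bounded_iff)
  \<comment> \<open>The maximum with 0 covers the points outside \<open>K\<close>; \<open>B\<close>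
    may be negative when \<open>K \<times> \<Gamma>\<close> is empty.\<close>
  have "\<bar>\<phi> p\<bar> \<le> max B 0" if "p \<in> \<Omega> \<times> \<Gamma>" for p
    using that K(3) B[of "\<phi> p"] by (cases p; cases "fst p \<in> K") auto
  then show ?thesis by (rule that)
qed

lemma partial_x_test_functions:
  assumes "open \<Omega>" "\<phi> \<in> test_functions (Suc r) \<Omega>"
  shows "partial_x i \<phi> \<in> test_functions r \<Omega>"
  using test_functions_frechet_derivative[OF assms] by (simp add: partial_x_def[abs_def])

lemma partial_z_test_functions:
  assumes "open \<Omega>" "\<phi> \<in> test_functions (Suc r) \<Omega>"
  shows "partial_z k \<phi> \<in> test_functions r \<Omega>"
  using test_functions_frechet_derivative[OF assms] by (simp add: partial_z_def[abs_def])

section \<open>Derivation of the Laplacian continuity equation\<close>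

theorem proposition23:
  fixes \<Omega> :: "(real^'d) set" and \<Gamma> :: "(real^'s) set"
    and E :: "((real^'d) \<times> (real^'s)) set \<Rightarrow> real^'s^'d"
    and \<mu> :: "((real^'d) \<times> (real^'s)) set \<Rightarrow> real"
    and e :: "(real^'d) \<times> (real^'s) \<Rightarrow> real^'s^'d"
  assumes "open \<Omega>" and "bounded \<Omega>" and "compact \<Gamma>"
    and "first_order_solution \<Omega> \<Gamma> E \<mu>"
    and "has_RN_density (borel_prod \<Omega> \<Gamma>) E \<mu> e"
    and "signed_integrable (borel_prod \<Omega> \<Gamma>) \<mu> (\<lambda>p. \<Sum>i\<in>UNIV. outer (e p $ i) (e p $ i))"
    and "\<forall>\<phi> \<in> test_functions 1 \<Omega>.
      vector_pairing (borel_prod \<Omega> \<Gamma>) (grad_x \<phi>) E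
      + signed_integral (borel_prod \<Omega> \<Gamma>) \<mu>
          (\<lambda>p. \<Sum>i\<in>UNIV. jacobian_z \<phi> p \<bullet> outer (e p $ i) (e p $ i)) = 0"
  shows "laplacian_solution \<Omega> \<Gamma>
    (signed_density (borel_prod \<Omega> \<Gamma>) \<mu> (\<lambda>p. \<Sum>i\<in>UNIV. outer (e p $ i) (e p $ i)))
    (\<lambda>A. 0) \<mu>"
proof -
  let ?M = "borel_prod \<Omega> \<Gamma>"
  let ?T = "\<lambda>p. \<Sum>i\<in>UNIV. outer (e p $ i) (e p $ i)"
  have sp: "space ?M = \<Omega> \<times> \<Gamma>" by (simp add: space_restrict_space)
  have op: "open (\<Omega> \<times> (UNIV :: (real^'s) set))"
    using assms(1) by (simp add: open_Times)
  have main: "- signed_integral ?M \<mu> (laplacian_x \<phi>)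
      + vector_pairing ?M (grad_z \<phi>) (\<lambda>A. 0)
      + vector_pairing ?M (hessian_z \<phi>) (signed_density ?M \<mu> ?T) = 0"
    if \<phi>: "\<phi> \<in> test_functions 2 \<Omega>" for \<phi>
  proof -
    have \<phi>': "\<phi> \<in> test_functions (Suc 1) \<Omega>" using \<phi> by (simp add: numeral_2_eq_2)
    have tx: "partial_x i \<phi> \<in> test_functions 1 \<Omega>" for i
      by (rule partial_x_test_functions[OF assms(1) \<phi>'])
    have tz: "partial_z k \<phi> \<in> test_functions 1 \<Omega>" for k
      by (rule partial_z_test_functions[OF assms(1) \<phi>'])
    have dx: "partial_x i \<phi> differentiable (at p)" and dz: "partial_z k \<phi> differentiable (at p)"
      if "p \<in> space ?M" for i k p
      using tx[of i] tz[of k] that by (auto simp: sp test_functions_def)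
    have sym: "frechet_derivative (\<lambda>q. frechet_derivative \<phi> (at q) v) (at p) w
        = frechet_derivative (\<lambda>q. frechet_derivative \<phi> (at q) w) (at p) v"
      if "p \<in> space ?M" for p v w
      using \<phi> that by (intro frechet_derivative_symmetric[OF op]) (auto simp: sp test_functions_def)
    define \<psi> where "\<psi> = (\<lambda>p. \<chi> i. partial_x i \<phi> p)"
    define \<eta> where "\<eta> = grad_z \<phi>"
    have \<psi>: "\<psi> \<in> test_functions 1 \<Omega>"
      unfolding \<psi>_def by (rule test_functions_vec_lambda[OF assms(1) tx])
    have \<eta>: "\<eta> \<in> test_functions 1 \<Omega>"
      unfolding \<eta>_def grad_z_def[abs_def] by (rule test_functions_vec_lambda[OF assms(1) tz])
    \<comment> \<open>Differentiation is componentwise at the points of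
      \<open>\<Omega> \<times> \<Gamma>\<close>, so the integrands below are compared on this space
      only.\<close>
    have d\<psi>: "frechet_derivative \<psi> (at p) v = (\<chi> i. frechet_derivative (partial_x i \<phi>) (at p) v)"
      and d\<eta>: "frechet_derivative \<eta> (at p) v = (\<chi> k. frechet_derivative (partial_z k \<phi>) (at p) v)"
      if "p \<in> space ?M" for p v
      unfolding \<psi>_def \<eta>_def grad_z_def[abs_def]
      by (rule frechet_derivative_vec_lambda, rule dx dz, rule that)+
    have "signed_integral ?M \<mu> (laplacian_x \<phi>) = signed_integral ?M \<mu> (div_x \<psi>)"
    proof (rule signed_integral_cong)
      fix p assume p: "p \<in> space ?M"
      show "laplacian_x \<phi> p = div_x \<psi> p"
        unfolding laplacian_x_def div_x_def partial_x_def[of _ \<psi>] d\<psi>[OF p]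
        by (simp add: partial_x_def)
    qed simp
    moreover have "signed_integral ?M \<mu> (div_x \<psi>) + vector_pairing ?M (jacobian_z \<psi>) E = 0"
      using assms(4) \<psi> by (simp add: first_order_solution_def)
    \<comment> \<open>Entry \<open>(i, k)\<close> is the derivative of \<phi> in x_i and then z_k on
      the left, and in z_k and then x_i on the right.\<close>
    moreover have "vector_pairing ?M (jacobian_z \<psi>) E = vector_pairing ?M (grad_x \<eta>) E"
    proof (rule vector_pairing_cong)
      fix p assume p: "p \<in> space ?M"
      show "jacobian_z \<psi> p = grad_x \<eta> p"
        unfolding jacobian_z_def grad_x_def partial_z_def[of _ \<psi>] partial_x_def[of _ \<eta>] d\<psi>[OF p] d\<eta>[OF p]
        unfolding partial_x_def[abs_def] partial_z_def[abs_def] vec_lambda_beta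
        by (intro arg_cong[where f=vec_lambda] ext sym[OF p])
    qed
    moreover have "vector_pairing ?M (grad_x \<eta>) E
        + signed_integral ?M \<mu> (\<lambda>p. jacobian_z \<eta> p \<bullet> ?T p) = 0"
      using assms(7) \<eta> by (simp add: inner_sum_right)
    \<comment> \<open>The Jacobian of the gradient is the transpose of
      \<open>hessian_z \<phi>\<close> as defined, so symmetry is used a second time, now within the
      z variables.\<close>
    moreover have "signed_integral ?M \<mu> (\<lambda>p. jacobian_z \<eta> p \<bullet> ?T p)
        = signed_integral ?M \<mu> (\<lambda>p. hessian_z \<phi> p \<bullet> ?T p)"
    proof (rule signed_integral_cong)
      fix p assume p: "p \<in> space ?M"
      have "jacobian_z \<eta> p = hessian_z \<phi> p"
        unfolding jacobian_z_def hessian_z_def partial_z_def[of _ \<eta>] d\<eta>[OF p]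
        unfolding partial_z_def[abs_def] vec_lambda_beta
        by (intro arg_cong[where f=vec_lambda] ext sym[OF p])
      then show "jacobian_z \<eta> p \<bullet> ?T p = hessian_z \<phi> p \<bullet> ?T p" by simp
    qed simp
    \<comment> \<open>A basis matrix selects one second derivative of \<phi>. This is a test
      function of class C^0, hence measurable and bounded on
      \<open>\<Omega> \<times> \<Gamma>\<close>.\<close>
    moreover have "vector_pairing ?M (hessian_z \<phi>) (signed_density ?M \<mu> ?T)
        = signed_integral ?M \<mu> (\<lambda>p. hessian_z \<phi> p \<bullet> ?T p)"
    proof (rule vector_pairing_signed_density[OF assms(6)])
      fix b :: "real^'s^'s" assume "b \<in> Basis"
      then obtain k l where "b = axis k (axis l 1)" by (auto simp: Basis_vec_def)
      then have b: "(\<lambda>p. hessian_z \<phi> p \<bullet> b) = partial_z k (partial_z l \<phi>)"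
        by (simp add: fun_eq_iff hessian_z_def inner_axis)
      have t: "partial_z k (partial_z l \<phi>) \<in> test_functions 0 \<Omega>"
        using tz by (auto intro: partial_z_test_functions[OF assms(1)])
      then have "continuous_on (\<Omega> \<times> UNIV) (partial_z k (partial_z l \<phi>))"
        by (simp add: test_functions_def)
      then have "continuous_on (\<Omega> \<times> \<Gamma>) (partial_z k (partial_z l \<phi>))"
        by (rule continuous_on_subset) auto
      then show "(\<lambda>p. hessian_z \<phi> p \<bullet> b) \<in> borel_measurable ?M"
        unfolding b by (rule borel_measurable_continuous_on_restrict)
      obtain B where "\<And>p. p \<in> \<Omega> \<times> \<Gamma> \<Longrightarrow> \<bar>partial_z k (partial_z l \<phi>) p\<bar> \<le> B"
        using test_functions_bounded[OF t assms(3)] by blast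
      then show "\<exists>B. \<forall>p\<in>space ?M. \<bar>hessian_z \<phi> p \<bullet> b\<bar> \<le> B"
        unfolding sp fun_cong[OF b] by blast
    qed
    \<comment> \<open>For the zero set function the positive and negative variations are the same
      measure, so the two integrals cancel.\<close>
    moreover have "vector_pairing ?M (grad_z \<phi>) (\<lambda>A. 0) = 0"
      by (simp add: vector_pairing_def signed_integral_def neg_variation_def)
    ultimately show ?thesis by linarith
  qed
  show ?thesis
    unfolding laplacian_solution_def
  proof (intro conjI ballI main)
    show "vector_measure ?M (signed_density ?M \<mu> ?T)"
      by (rule vector_measure_signed_density[OF assms(6)])
    show "vector_measure ?M \<mu>"
      using assms(4) by (simp add: first_order_solution_def)
  qed (simp_all add: vector_measure_def)
qed

end
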